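(* Let $\Lambda\in S_1(\mathbb R)$ and suppose that $\operatorname{supp}\Lambda$ is compact. Let $\nu\in M(\mathbb T)$ and let $\mu\in M(\mathbb R)$ be the measure defined by $\hat\mu(\xi)=W_{\hat\nu,\Lambda}(\xi)=\sum_{n\in\mathbb Z}\hat\nu(n)\Lambda(\xi-n)$. If $\nu$ is a continuous measure, then $\mu$ is a continuous measure.
   Context: $M(\mathbb R)$ and $M(\mathbb T)$ are the spaces of bounded regular (complex) Borel measures on $\mathbb R$ and on $\mathbb T$; $\mathbb T$ is identified with $[0,1)$. Fourier transforms are $\hat\mu(\xi)=\int_{\mathbb R}e^{-2\pi i\xi x}\,d\mu(x)$ for $\mu\in M(\mathbb R)$ and $\hat\nu(n)=\int_{\mathbb T}e^{-2\pi i n x}\,d\nu(x)$ for $\nu\in M(\mathbb T)$. A measure is continuous if it gives mass zero to every single point. $M_1(\mathbb R)$ denotes the Fourier multipliers of $L^1(\mathbb R)$ and $M_1(\mathbb Z)$ those of $L^1(\mathbb T)$, with operator norms; they are identified with $M(\mathbb R)$ and $M(\mathbb T)$ respectively (via $\mu\mapsto\hat\mu$, $\nu\mapsto\hat\nu$). $S_1(\mathbb R)$ (summability kernels for $L^1(\mathbb R)$ multipliers) is the set of measurable functions $\Lambda$ on $\mathbb R$ such that for each $\phi\in M_1(\mathbb Z)$ the series $W_{\phi,\Lambda}(\xi)=\sum_{n\in\mathbb Z}\phi(n)\Lambda(\xi-n)$ converges a.e., belongs to $M_1(\mathbb R)$ (hence is a.e. equal to the Fourier transform of a measure in $M(\mathbb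 R)$), and there is a constant $C_{1,\Lambda}$ (independent of $\phi$) with $\|W_{\phi,\Lambda}\|_{M_1(\mathbb R)}\le C_{1,\Lambda}\|\phi\|_{M_1(\mathbb Z)}$. *)

theory Defs
  imports "HOL-Analysis.Analysis"
begin

section \<open>Complex measures\<close>

text \<open>
  Only the measurable space underlying M matters. Taking all sets empty forces the value 0 on the
  empty set. A countably additive complex set function automatically has finite total variation,
  and on the Borel sets of the real line or the circle it is automatically regular, so with
  these sigma-algebras this is exactly the space of bounded regular complex Borel measures.
\<close>
definition complex_measure :: "'a measure \<Rightarrow> ('a set \<Rightarrow> complex) \<Rightarrow> bool" where
  "complex_measure M \<mu> \<longleftrightarrow>
     (\<forall>A :: nat \<Rightarrow> 'a set. range A \<subseteq> sets M \<longrightarrow> disjoint_family A \<longrightarrow>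
        (\<lambda>i. \<mu> (A i)) sums \<mu> (\<Union>i. A i))"

definition continuous_measure :: "'a measure \<Rightarrow> ('a set \<Rightarrow> complex) \<Rightarrow> bool" where
  "continuous_measure M \<mu> \<longleftrightarrow> (\<forall>x\<in>space M. \<mu> {x} = 0)"

text \<open>
  The positive part in the Jordan decomposition of a signed measure s; the negative part
  is the positive part of the negation of s.
\<close>
definition jordan_pos :: "'a measure \<Rightarrow> ('a set \<Rightarrow> real) \<Rightarrow> 'a measure" where
  "jordan_pos M s =
     measure_of (space M) (sets M) (\<lambda>A. SUP B\<in>{B \<in> sets M. B \<subseteq> A}. ennreal (s B))"

definition complex_integral ::
    "'a measure \<Rightarrow> ('a set \<Rightarrow> complex) \<Rightarrow> ('a \<Rightarrow> complex) \<Rightarrow> complex" where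
  "complex_integral M \<mu> f =
     (LINT x|jordan_pos M (\<lambda>A. Re (\<mu> A)). f x)
     - (LINT x|jordan_pos M (\<lambda>A. - Re (\<mu> A)). f x)
     + \<i> * ((LINT x|jordan_pos M (\<lambda>A. Im (\<mu> A)). f x)
            - (LINT x|jordan_pos M (\<lambda>A. - Im (\<mu> A)). f x))"

text \<open>
  The circle is identified with [0,1); under this identification the Borel sets of the circle
  are the Borel subsets of [0,1).
\<close>
abbreviation borel_T :: "real measure" where
  "borel_T \<equiv> restrict_space borel {0..<1}"

abbreviation lebesgue_T :: "real measure" where
  "lebesgue_T \<equiv> lebesgue_on {0..<1}"

section \<open>Fourier transforms of measures and of integrable functions\<close>

definition fourier_measure_R :: "(real set \<Rightarrow> complex) \<Rightarrow> real \<Rightarrow> complex" where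
  "fourier_measure_R \<mu> \<xi> = complex_integral borel \<mu> (\<lambda>x. cis (- 2 * pi * \<xi> * x))"

definition fourier_measure_T :: "(real set \<Rightarrow> complex) \<Rightarrow> int \<Rightarrow> complex" where
  "fourier_measure_T \<nu> n = complex_integral borel_T \<nu> (\<lambda>x. cis (- 2 * pi * of_int n * x))"

definition fourier_R :: "(real \<Rightarrow> complex) \<Rightarrow> real \<Rightarrow> complex" where
  "fourier_R f \<xi> = (LINT x|lebesgue. cis (- 2 * pi * \<xi> * x) * f x)"

definition fourier_T :: "(real \<Rightarrow> complex) \<Rightarrow> int \<Rightarrow> complex" where
  "fourier_T f n = (LINT x|lebesgue_T. cis (- 2 * pi * of_int n * x) * f x)"

section \<open>Fourier multipliers of the L1 spaces\<close>

definition L1_norm :: "'a measure \<Rightarrow> ('a \<Rightarrow> complex) \<Rightarrow> real" where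
  "L1_norm M f = (LINT x|M. norm (f x))"

text \<open>
  The constants C for which the multiplier operator, sending f to the function g whose transform
  is m times that of f, is defined on all of L1 with norm at most C. By uniqueness
  of Fourier transforms, g is determined almost everywhere by f.
\<close>
definition multiplier_bounds_R :: "(real \<Rightarrow> complex) \<Rightarrow> real set" where
  "multiplier_bounds_R m =
     {C. C \<ge> 0 \<and> (\<forall>f. integrable lebesgue f \<longrightarrow>
        (\<exists>g. integrable lebesgue g \<and>
             (AE \<xi> in lebesgue. fourier_R g \<xi> = m \<xi> * fourier_R f \<xi>) \<and>
             L1_norm lebesgue g \<le> C * L1_norm lebesgue f))}"

definition multiplier_bounds_Z :: "(int \<Rightarrow> complex) \<Rightarrow> real set" where
  "multiplier_bounds_Z \<phi> =
     {C. C \<ge> 0 \<and> (\<forall>f. integrable lebesgue_T f \<longrightarrow>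
        (\<exists>g. integrable lebesgue_T g \<and>
             (\<forall>n. fourier_T g n = \<phi> n * fourier_T f n) \<and>
             L1_norm lebesgue_T g \<le> C * L1_norm lebesgue_T f))}"

definition M1_R :: "(real \<Rightarrow> complex) set" where
  "M1_R = {m \<in> borel_measurable lebesgue. multiplier_bounds_R m \<noteq> {}}"

definition M1_Z :: "(int \<Rightarrow> complex) set" where
  "M1_Z = {\<phi>. multiplier_bounds_Z \<phi> \<noteq> {}}"

definition M1_R_norm :: "(real \<Rightarrow> complex) \<Rightarrow> real" where
  "M1_R_norm m = Inf (multiplier_bounds_R m)"

definition M1_Z_norm :: "(int \<Rightarrow> complex) \<Rightarrow> real" where
  "M1_Z_norm \<phi> = Inf (multiplier_bounds_Z \<phi>)"

section \<open>Summability kernels\<close>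

text \<open>
  Two-sided series are limits of symmetric partial sums. For a kernel of compact support the
  mode of summation is immaterial: almost every such series has only finitely many
  nonzero terms.
\<close>
definition W_partial ::
    "(int \<Rightarrow> complex) \<Rightarrow> (real \<Rightarrow> complex) \<Rightarrow> real \<Rightarrow> nat \<Rightarrow> complex" where
  "W_partial \<phi> \<Lambda> \<xi> N = (\<Sum>n\<in>{- int N..int N}. \<phi> n * \<Lambda> (\<xi> - of_int n))"

definition W :: "(int \<Rightarrow> complex) \<Rightarrow> (real \<Rightarrow> complex) \<Rightarrow> real \<Rightarrow> complex" where
  "W \<phi> \<Lambda> \<xi> = lim (W_partial \<phi> \<Lambda> \<xi>)"

definition S1_R :: "(real \<Rightarrow> complex) set" where
  "S1_R = {\<Lambda> \<in> borel_measurable lebesgue.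
     \<exists>C. \<forall>\<phi>\<in>M1_Z.
       (AE \<xi> in lebesgue. convergent (W_partial \<phi> \<Lambda> \<xi>)) \<and>
       W \<phi> \<Lambda> \<in> M1_R \<and>
       M1_R_norm (W \<phi> \<Lambda>) \<le> C * M1_Z_norm \<phi>}"

text \<open>
  The support of a measurable function, insensitive to changes on null sets: the complement of
  the largest open set on which the function vanishes almost everywhere. It is contained in
  the closure of the set where the function is nonzero, with equality for continuous functions.
\<close>
definition ess_support :: "(real \<Rightarrow> complex) \<Rightarrow> real set" where
  "ess_support \<Lambda> =
     - \<Union>{U. open U \<and> (AE x in lebesgue. x \<in> U \<longrightarrow> \<Lambda> x = 0)}"

end

theory Submission
  imports Defs "HOL-Real_Asymp.Real_Asymp"
begin

text \<open>
  By Wiener's formula, the mass of \<mu> at x is the limit of the averages of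
  exp(2 pi i \<xi> x) times the transform of \<mu> over -N \<le> \<xi> \<le> N. A compactly supported kernel
  \<Lambda> in S1 is itself a multiplier, hence bounded and integrable. Inserting the series
  and integrating term by term, all but boundedly many terms n contribute the full integral of
  exp(2 pi i u x) \<Lambda>(u) times exp(2 pi i n x) times the n-th coefficient of \<nu>. The averages
  are therefore asymptotic to this constant times the symmetric means of the coefficients of
  \<nu>, and by Wiener's formula on the circle these tend to the mass of \<nu> at x mod 1, which is zero.
\<close>

section \<open>Signed and complex measures\<close>

text \<open>Both Wiener formulas rest on one fact: averages of characters at x - y are bounded by 1
  and tend to the indicator of y = x, so dominated convergence isolates a single mass. Since
  \<open>complex_integral\<close> is assembled from four set functions \<open>jordan_pos\<close>,
  these must first be shown to be finite measures whose differences give back the real and imaginary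
  parts; each limit or exchange of integrals is then made on all four. The obstacle on the line is
  null sets: \<Lambda> is only Lebesgue measurable, and the identity for \<mu> holds only almost
  everywhere. Hence \<Lambda> is replaced by a Borel representative whose bound and zeros hold
  pointwise, and the exceptional set is enlarged by its integer translates, because the series at
  \<xi> samples \<Lambda> at every \<xi> - n. Compactness of the support makes this series a finite
  sum with a range common to all |\<xi>| <= N.\<close>

locale signed_measure =
  fixes M :: "'a measure" and s :: "'a set \<Rightarrow> real"
  assumes sums: "range A \<subseteq> sets M \<Longrightarrow> disjoint_family A \<Longrightarrow> (\<lambda>i. s (A i)) sums s (\<Union>i::nat. A i)"
begin

lemma empty [simp]: "s {} = 0"
proof -
  have "(\<lambda>i::nat. s {}) sums s (\<Union>i::nat. {})"
    by (rule sums) (auto simp: disjoint_family_on_def)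
  then have "(\<lambda>i::nat. s {}) \<longlonglongrightarrow> 0"
    by (intro summable_LIMSEQ_zero sums_summable)
  then show ?thesis
    by (simp add: LIMSEQ_const_iff)
qed

lemma Un:
  assumes "A \<in> sets M" "B \<in> sets M" "A \<inter> B = {}"
  shows "s (A \<union> B) = s A + s B"
proof -
  have "(\<lambda>i. s (binaryset A B i)) sums s (\<Union>i. binaryset A B i)"
    using assms by (intro sums) (auto simp: range_binaryset_eq disjoint_family_on_def binaryset_def)
  moreover have "(\<lambda>i. s (binaryset A B i)) sums (s A + s B)"
    by (rule binaryset_sums) simp
  ultimately show ?thesis
    by (simp add: UN_binaryset_eq sums_unique2)
qed

lemma Diff:
  assumes "A \<in> sets M" "B \<in> sets M" "B \<subseteq> A"
  shows "s (A - B) = s A - s B"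
  using Un[of B "A - B"] assms by (simp add: Un_absorb1)

text \<open>The differences of consecutive sets are disjoint, so their masses form a convergent
  series, and its partial sums telescope to \<open>s (E 0) - s (E n)\<close>.\<close>

lemma convergent_decseq:
  assumes E: "\<And>i::nat. E i \<in> sets M" "\<And>i. E (Suc i) \<subseteq> E i"
  shows "convergent (\<lambda>i. s (E i))"
proof -
  have dec: "decseq E" using E(2) by (rule decseq_SucI)
  have "disjoint_family (\<lambda>i. E i - E (Suc i))"
    unfolding disjoint_family_on_def
  proof (intro ballI impI)
    have *: "(E m - E (Suc m)) \<inter> (E n - E (Suc n)) = {}" if "m < n" for m n
      using decseqD[OF dec, of "Suc m" n] that by auto
    show "(E m - E (Suc m)) \<inter> (E n - E (Suc n)) = {}" if "m \<noteq> n" for m n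
      using that *[of m n] *[of n m] by (cases "m < n") auto
  qed
  then have "summable (\<lambda>i. s (E i - E (Suc i)))"
    using E by (intro sums_summable[OF sums]) auto
  also have "(\<lambda>i. s (E i - E (Suc i))) = (\<lambda>i. s (E i) - s (E (Suc i)))"
    using E by (simp add: Diff)
  finally have "convergent (\<lambda>n. \<Sum>i<n. s (E i) - s (E (Suc i)))"
    by (simp add: summable_iff_convergent)
  also have "(\<lambda>n. \<Sum>i<n. s (E i) - s (E (Suc i))) = (\<lambda>n. s (E 0) - s (E n))"
    by (intro ext sum_lessThan_telescope')
  finally have c: "convergent (\<lambda>n. s (E 0) - s (E n))" .
  show ?thesis
    using convergent_diff[OF convergent_const[of "s (E 0)"] c] by simp
qed

text \<open>
  If s were unbounded on the measurable subsets of E, then E could be split into two pieces of large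
  absolute measure, and s would again be unbounded below one of them. Iterating gives a decreasing
  sequence of sets along which s diverges.
\<close>
lemma bounded: "\<exists>K. \<forall>B\<in>sets M. \<bar>s B\<bar> \<le> K"
proof (rule ccontr)
  define unb where "unb E \<longleftrightarrow> (\<forall>K. \<exists>B\<in>sets M. B \<subseteq> E \<and> K < \<bar>s B\<bar>)" for E
  assume "\<not> ?thesis"
  then have "unb (space M)"
    unfolding unb_def by (meson not_le sets.sets_into_space)
  have step: "\<exists>F. (F \<in> sets M \<and> unb F \<and> real (Suc n) \<le> \<bar>s F\<bar>) \<and> F \<subseteq> E"
    if E: "E \<in> sets M" "unb E" for E and n :: nat
  proof -
    \<comment> \<open>Adding |s E| to the threshold makes the complement large too: |s (E - B)| >=
      |s B| - |s E|. So whichever half stays unbounded can be kept.\<close>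
    obtain B where B: "B \<in> sets M" "B \<subseteq> E" "\<bar>s E\<bar> + real (Suc n) < \<bar>s B\<bar>"
      using E(2) unfolding unb_def by meson
    have d: "s (E - B) = s E - s B" using E B by (intro Diff) auto
    have "unb B \<or> unb (E - B)"
    proof (rule ccontr)
      assume "\<not> ?thesis"
      then obtain K L where K: "\<And>C. C \<in> sets M \<Longrightarrow> C \<subseteq> B \<Longrightarrow> \<bar>s C\<bar> \<le> K"
        and L: "\<And>C. C \<in> sets M \<Longrightarrow> C \<subseteq> E - B \<Longrightarrow> \<bar>s C\<bar> \<le> L"
        unfolding unb_def by (meson not_le)
      obtain C where C: "C \<in> sets M" "C \<subseteq> E" "K + L < \<bar>s C\<bar>"
        using E(2) unfolding unb_def by meson
      have "s C = s (C \<inter> B) + s (C - B)"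
        using B C Un[of "C \<inter> B" "C - B"] by (simp add: Int_Diff_Un Int_Diff_disjoint)
      moreover have "\<bar>s (C \<inter> B)\<bar> \<le> K" "\<bar>s (C - B)\<bar> \<le> L"
        using B C by (auto intro!: K L)
      ultimately show False using C(3) by linarith
    qed
    then show ?thesis
    proof
      assume "unb B" then show ?thesis using B by (intro exI[of _ B]) auto
    next
      assume "unb (E - B)" then show ?thesis using B E d by (intro exI[of _ "E - B"]) auto
    qed
  qed
  have "\<exists>E. \<forall>n. (E n \<in> sets M \<and> unb (E n) \<and> real n \<le> \<bar>s (E n)\<bar>) \<and> E (Suc n) \<subseteq> E n"
    using \<open>unb (space M)\<close> step
    by (intro dependent_nat_choice) (auto intro!: exI[of _ "space M"])
  then obtain E where E: "\<And>n. E n \<in> sets M" "\<And>n. real n \<le> \<bar>s (E n)\<bar>" "\<And>n. E (Suc n) \<subseteq> E n"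
    by auto
  then have "convergent (\<lambda>n. s (E n))"
    by (intro convergent_decseq)
  then obtain K where "\<And>n. \<bar>s (E n)\<bar> \<le> K"
    using convergent_imp_Bseq[of "\<lambda>n. s (E n)"] by (auto simp: Bseq_def)
  moreover obtain n where "K < real n" using reals_Archimedean2 by blast
  ultimately show False using E(2)[of n] by (meson not_le order_trans)
qed

section \<open>The Jordan decomposition of a signed measure\<close>

lemma sets_jordan_pos [simp]: "sets (jordan_pos M s) = sets M"
  and space_jordan_pos [simp]: "space (jordan_pos M s) = space M"
  by (auto simp: jordan_pos_def sets.space_closed)

text \<open>\<open>measure_of\<close> falls back to zero unless the given function is a measure, so
  countable additivity of the supremum is the content. One inequality is superadditivity on disjoint
  sets; the other splits a competitor B along the A i.\<close>

lemma emeasure_jordan_pos: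
  assumes "A \<in> sets M"
  shows "emeasure (jordan_pos M s) A = (SUP B\<in>{B \<in> sets M. B \<subseteq> A}. ennreal (s B))"
proof -
  define P where "P A = (SUP B\<in>{B \<in> sets M. B \<subseteq> A}. ennreal (s B))" for A
  have le_P: "ennreal (s B) \<le> P A" if "B \<in> sets M" "B \<subseteq> A" for A B
    unfolding P_def using that by (intro SUP_upper) auto
  have P_mono: "P A \<le> P B" if "A \<subseteq> B" for A B
    unfolding P_def using that by (intro SUP_subset_mono) auto
  have P_empty: "P {} = 0"
  proof -
    have "{B \<in> sets M. B \<subseteq> {}} = {{}}" by auto
    then show ?thesis by (simp add: P_def)
  qed
  have P_Un: "P A + P B \<le> P (A \<union> B)" if AB: "A \<inter> B = {}" for A B
  proof -
    \<comment> \<open>A set of negative mass has \<open>ennreal\<close> value 0 and may be exchanged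
      for the empty set. With nonnegative masses, \<open>ennreal\<close> of the union is the
      sum.\<close>
    have ex: "\<exists>C'. C' \<in> sets M \<and> C' \<subseteq> A \<and> 0 \<le> s C' \<and> ennreal (s C) = ennreal (s C')"
      if "C \<in> sets M" "C \<subseteq> A" for C A
      using that by (cases "0 \<le> s C") (auto intro: exI[of _ "{}"] simp: ennreal_neg)
    have "ennreal (s C) + ennreal (s D) \<le> P (A \<union> B)"
      if CD: "C \<in> sets M" "C \<subseteq> A" "D \<in> sets M" "D \<subseteq> B" for C D
    proof -
      obtain C' D' where C': "C' \<in> sets M" "C' \<subseteq> A" "0 \<le> s C'" "ennreal (s C) = ennreal (s C')"
        and D': "D' \<in> sets M" "D' \<subseteq> B" "0 \<le> s D'" "ennreal (s D) = ennreal (s D')"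
        using ex[OF CD(1,2)] ex[OF CD(3,4)] by blast
      have "ennreal (s C) + ennreal (s D) = ennreal (s (C' \<union> D'))"
        using C' D' AB by (subst Un) auto
      also have "\<dots> \<le> P (A \<union> B)"
        using C' D' by (intro le_P) auto
      finally show ?thesis .
    qed
    then have "P A + ennreal (s D) \<le> P (A \<union> B)" if "D \<in> sets M" "D \<subseteq> B" for D
      unfolding P_def[of A] using that
      by (subst ennreal_SUP_add_left[symmetric]) (auto intro!: SUP_least)
    then show ?thesis
      unfolding P_def[of B] add.commute[of "P A"]
      by (subst ennreal_SUP_add_left[symmetric]) (auto intro!: SUP_least)
  qed
  have "emeasure (jordan_pos M s) A = P A"
    unfolding jordan_pos_def P_def[symmetric]
  proof (rule emeasure_measure_of_sigma[OF _ _ _ assms])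
    show "sigma_algebra (space M) (sets M)" ..
    show "positive (sets M) P" by (simp add: positive_def P_empty)
    show "countably_additive (sets M) P"
      unfolding countably_additive_def
    proof (intro allI impI)
      fix A :: "nat \<Rightarrow> 'a set"
      assume A: "range A \<subseteq> sets M" "disjoint_family A"
      have fin: "(\<Sum>i<n. P (A i)) \<le> P (\<Union>i<n. A i)" for n
      proof (induction n)
        case (Suc n)
        have "x \<notin> A n" if "i < n" "x \<in> A i" for i x
          using disjoint_family_onD[OF A(2), of i n] that by auto
        then have disj: "(\<Union>i<n. A i) \<inter> A n = {}"
          by auto
        have "(\<Sum>i<Suc n. P (A i)) \<le> P (\<Union>i<n. A i) + P (A n)"
          using Suc by (simp add: add_right_mono)
        also have "\<dots> \<le> P ((\<Union>i<n. A i) \<union> A n)"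
          by (rule P_Un[OF disj])
        also have "(\<Union>i<n. A i) \<union> A n = (\<Union>i<Suc n. A i)"
          by (auto simp: lessThan_Suc)
        finally show ?case .
      qed (simp add: P_empty)
      have "(\<Sum>i. P (A i)) \<le> P (\<Union>i. A i)"
        by (rule suminf_le_const) (auto intro: order_trans[OF fin P_mono])
      moreover have "P (\<Union>i. A i) \<le> (\<Sum>i. P (A i))"
        unfolding P_def[of "\<Union>i. A i"]
      proof (rule SUP_least, clarify)
        fix B assume B: "B \<in> sets M" "B \<subseteq> (\<Union>i. A i)"
        have "(\<lambda>i. s (B \<inter> A i)) sums s (\<Union>i. B \<inter> A i)"
          using A B by (intro sums) (auto simp: disjoint_family_on_def)
        also have "(\<Union>i. B \<inter> A i) = B" using B by auto
        finally have lim: "(\<lambda>n. ennreal (\<Sum>i<n. s (B \<inter> A i))) \<longlonglongrightarrow> ennreal (s B)"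
          by (intro tendsto_ennrealI) (simp add: sums_def)
        have "ennreal (\<Sum>i<n. s (B \<inter> A i)) \<le> (\<Sum>i. P (A i))" for n
        proof -
          \<comment> \<open>\<open>ennreal\<close> is not additive on terms of mixed sign, so the
            terms are truncated at zero before it moves inside the sum.\<close>
          have "ennreal (\<Sum>i<n. s (B \<inter> A i)) \<le> ennreal (\<Sum>i<n. max 0 (s (B \<inter> A i)))"
            by (intro ennreal_leI sum_mono) auto
          also have "\<dots> = (\<Sum>i<n. ennreal (max 0 (s (B \<inter> A i))))"
            by (rule sum_ennreal[symmetric]) simp
          also have "\<dots> = (\<Sum>i<n. ennreal (s (B \<inter> A i)))"
            by (intro sum.cong) (auto simp: max_def ennreal_neg)
          also have "\<dots> \<le> (\<Sum>i<n. P (A i))"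
            using A B by (intro sum_mono le_P) auto
          also have "\<dots> \<le> (\<Sum>i. P (A i))"
            by (intro sum_le_suminf) auto
          finally show ?thesis .
        qed
        then show "ennreal (s B) \<le> (\<Sum>i. P (A i))"
          by (intro LIMSEQ_le_const2[OF lim]) auto
      qed
      ultimately show "(\<Sum>i. P (A i)) = P (\<Union>i. A i)" by simp
    qed
  qed
  then show ?thesis by (simp add: P_def)
qed

lemma finite_measure_jordan_pos: "finite_measure (jordan_pos M s)"
proof
  obtain K where "\<And>B. B \<in> sets M \<Longrightarrow> \<bar>s B\<bar> \<le> K" using bounded by auto
  then have "emeasure (jordan_pos M s) (space M) \<le> ennreal K"
    by (subst emeasure_jordan_pos) (auto intro!: SUP_least ennreal_leI dest: abs_le_D1)
  then show "emeasure (jordan_pos M s) (space (jordan_pos M s)) \<noteq> \<infinity>"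
    by (auto simp: top_unique)
qed

lemma le_measure_jordan_pos:
  assumes "A \<in> sets M" "B \<in> sets M" "B \<subseteq> A"
  shows "s B \<le> measure (jordan_pos M s) A"
proof -
  interpret finite_measure "jordan_pos M s" by (rule finite_measure_jordan_pos)
  have "ennreal (s B) \<le> emeasure (jordan_pos M s) A"
    using assms by (subst emeasure_jordan_pos) (auto intro!: SUP_upper)
  then show ?thesis
    by (simp add: emeasure_eq_measure)
qed

lemma measure_jordan_pos_le:
  assumes "A \<in> sets M" "\<And>B. B \<in> sets M \<Longrightarrow> B \<subseteq> A \<Longrightarrow> s B \<le> c"
  shows "measure (jordan_pos M s) A \<le> c"
proof -
  interpret finite_measure "jordan_pos M s" by (rule finite_measure_jordan_pos)
  have "0 \<le> c" using assms(2)[of "{}"] by simp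
  have "emeasure (jordan_pos M s) A \<le> ennreal c"
    using assms by (subst emeasure_jordan_pos) (auto intro!: SUP_least ennreal_leI)
  then show ?thesis
    using \<open>0 \<le> c\<close> by (simp add: emeasure_eq_measure)
qed

lemma uminus: "signed_measure M (\<lambda>A. - s A)"
  by standard (intro sums_minus sums)

text \<open>No Hahn decomposition is involved. For B inside A, - t B = t (A - B) - t A is at most
  the positive part of A minus t A; the supremum over B gives one inequality, and t = s and t = - s
  give both.\<close>

lemma jordan_decomposition:
  assumes A: "A \<in> sets M"
  shows "s A = measure (jordan_pos M s) A - measure (jordan_pos M (\<lambda>A. - s A)) A"
proof -
  have *: "measure (jordan_pos M (\<lambda>A. - t A)) A \<le> measure (jordan_pos M t) A - t A"
    if "signed_measure M t" for t
  proof -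
    interpret t: signed_measure M t by fact
    interpret n: signed_measure M "\<lambda>A. - t A" by (rule t.uminus)
    show ?thesis
    proof (rule n.measure_jordan_pos_le[OF A])
      fix B assume B: "B \<in> sets M" "B \<subseteq> A"
      have "t (A - B) \<le> measure (jordan_pos M t) A"
        using A B by (intro t.le_measure_jordan_pos) auto
      then show "- t B \<le> measure (jordan_pos M t) A - t A"
        using t.Diff[OF A B] by simp
    qed
  qed
  from *[OF signed_measure_axioms] *[OF uminus] show ?thesis by simp
qed

end

section \<open>Integration against a complex measure\<close>

lemma norm_integral_le_measure:
  fixes f :: "'a \<Rightarrow> complex"
  assumes "finite_measure m" "f \<in> borel_measurable m" "\<And>x. norm (f x) \<le> 1"
  shows "norm (LINT x|m. f x) \<le> measure m (space m)"
proof -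
  interpret finite_measure m by fact
  have f: "integrable m f"
    using assms(2,3) by (intro integrable_const_bound[where B=1]) auto
  have "norm (LINT x|m. f x) \<le> (LINT x|m. norm (f x))"
    by (rule integral_norm_bound)
  also have "\<dots> \<le> (LINT x|m. 1)"
    using f assms(3) by (intro integral_mono) auto
  finally show ?thesis by simp
qed

locale complex_measure_on =
  fixes M :: "'a measure" and \<mu> :: "'a set \<Rightarrow> complex"
  assumes complex_measure: "complex_measure M \<mu>"
begin

abbreviation "re_pos \<equiv> jordan_pos M (\<lambda>A. Re (\<mu> A))"
abbreviation "re_neg \<equiv> jordan_pos M (\<lambda>A. - Re (\<mu> A))"
abbreviation "im_pos \<equiv> jordan_pos M (\<lambda>A. Im (\<mu> A))"
abbreviation "im_neg \<equiv> jordan_pos M (\<lambda>A. - Im (\<mu> A))"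

sublocale re: signed_measure M "\<lambda>A. Re (\<mu> A)"
  using complex_measure unfolding complex_measure_def by unfold_locales (auto simp: sums_complex_iff)
sublocale im: signed_measure M "\<lambda>A. Im (\<mu> A)"
  using complex_measure unfolding complex_measure_def by unfold_locales (auto simp: sums_complex_iff)
sublocale nre: signed_measure M "\<lambda>A. - Re (\<mu> A)" by (rule re.uminus)
sublocale nim: signed_measure M "\<lambda>A. - Im (\<mu> A)" by (rule im.uminus)

sublocale re: finite_measure re_pos by (rule re.finite_measure_jordan_pos)
sublocale nre: finite_measure re_neg by (rule nre.finite_measure_jordan_pos)
sublocale im: finite_measure im_pos by (rule im.finite_measure_jordan_pos)
sublocale nim: finite_measure im_neg by (rule nim.finite_measure_jordan_pos)

text \<open>An upper bound for the total variation, in general larger than it; it bounds all Fourier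
  coefficients at once.\<close>

definition variation_bound :: real where
  "variation_bound =
     measure re_pos (space M) + measure re_neg (space M) + measure im_pos (space M) + measure im_neg (space M)"

lemma norm_complex_integral_le:
  assumes "f \<in> borel_measurable M" "\<And>x. norm (f x) \<le> 1"
  shows "norm (complex_integral M \<mu> f) \<le> variation_bound"
proof -
  have *: "norm (LINT x|m. f x) \<le> measure m (space M)"
    if "finite_measure m" "sets m = sets M" for m
    using norm_integral_le_measure[OF that(1), of f] that(2) assms
    by (simp add: sets_eq_imp_space_eq[OF that(2)] cong: measurable_cong_sets)
  have "norm (complex_integral M \<mu> f) \<le>
      norm (LINT x|re_pos. f x) + norm (LINT x|re_neg. f x) + norm (LINT x|im_pos. f x) + norm (LINT x|im_neg. f x)"
    unfolding complex_integral_def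
    by (intro order_trans[OF norm_triangle_ineq] order_trans[OF add_mono[OF norm_triangle_ineq4 order_refl]])
       (auto simp: norm_mult intro: norm_triangle_ineq4)
  also have "\<dots> \<le> variation_bound"
    unfolding variation_bound_def
    by (intro add_mono *) (simp_all add: re.finite_measure_axioms nre.finite_measure_axioms
          im.finite_measure_axioms nim.finite_measure_axioms)
  finally show ?thesis .
qed

lemma complex_integral_indicator:
  assumes "A \<in> sets M"
  shows "complex_integral M \<mu> (indicator A) = \<mu> A"
proof -
  have *: "(LINT x|m. indicator A x :: complex) = of_real (measure m A)"
    if "sets m = sets M" for m
  proof -
    have "(LINT x|m. indicator A x :: complex) = (LINT x|m. of_real (indicator A x))"
      by (intro Bochner_Integration.integral_cong) (auto simp: indicator_def)
    also have "\<dots> = of_real (LINT x|m. indicator A x)"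
      by (rule integral_complex_of_real)
    finally show ?thesis
      using that assms sets.sets_into_space[of A m] by (simp add: Int_absorb2)
  qed
  show ?thesis
    unfolding complex_integral_def
    by (simp add: * complex_eq_iff re.jordan_decomposition[OF assms] im.jordan_decomposition[OF assms])
qed

lemma tendsto_complex_integral:
  fixes f :: "nat \<Rightarrow> 'a \<Rightarrow> complex"
  assumes [measurable]: "\<And>n. f n \<in> borel_measurable M" "g \<in> borel_measurable M"
    and "\<And>n x. norm (f n x) \<le> 1" "\<And>x. x \<in> space M \<Longrightarrow> (\<lambda>n. f n x) \<longlonglongrightarrow> g x"
  shows "(\<lambda>n. complex_integral M \<mu> (f n)) \<longlonglongrightarrow> complex_integral M \<mu> g"
proof -
  have *: "(\<lambda>n. LINT x|m. f n x) \<longlonglongrightarrow> (LINT x|m. g x)"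
    if "finite_measure m" "sets m = sets M" for m
  proof -
    interpret finite_measure m by fact
    have [measurable_cong]: "sets m = sets M" by fact
    show ?thesis
      using assms that sets_eq_imp_space_eq[OF that(2)]
      by (intro integral_dominated_convergence[where w="\<lambda>_. 1"]) auto
  qed
  show ?thesis
    unfolding complex_integral_def
    by (intro tendsto_intros *) (simp_all add: re.finite_measure_axioms nre.finite_measure_axioms
          im.finite_measure_axioms nim.finite_measure_axioms)
qed

text \<open>A bounded measurable integrand is integrable on the product of two finite measures, so
  Fubini applies to each of the four parts. Integrability of the inner integral will also supply the
  measurability of Fourier transforms.\<close>

lemma complex_integral_Fubini:
  fixes g :: "'b \<Rightarrow> 'a \<Rightarrow> complex"
  assumes "finite_measure L"
    and [measurable]: "case_prod g \<in> borel_measurable (L \<Otimes>\<^sub>M M)"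
    and bound: "\<And>x y. norm (g x y) \<le> K"
  shows "integrable L (\<lambda>x. complex_integral M \<mu> (g x))" (is ?int)
    and "(LINT x|L. complex_integral M \<mu> (g x)) = complex_integral M \<mu> (\<lambda>y. LINT x|L. g x y)" (is ?eq)
proof -
  have *: "integrable L (\<lambda>x. LINT y|m. g x y)"
     "(LINT x|L. LINT y|m. g x y) = (LINT y|m. LINT x|L. g x y)"
    if m: "finite_measure m" "sets m = sets M" for m
  proof -
    have [measurable_cong]: "sets m = sets M" by fact
    interpret m: finite_measure m by fact
    interpret L: finite_measure L by fact
    interpret pair_sigma_finite L m ..
    interpret P: finite_measure "L \<Otimes>\<^sub>M m"
      by (rule finite_measure_pair_measure) unfold_locales
    have "integrable (L \<Otimes>\<^sub>M m) (case_prod g)"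
      using bound by (intro P.integrable_const_bound[where B=K]) auto
    then show "integrable L (\<lambda>x. LINT y|m. g x y)"
     "(LINT x|L. LINT y|m. g x y) = (LINT y|m. LINT x|L. g x y)"
      by (auto intro: integrable_fst' simp: Fubini_integral dest: integrable_fst')
  qed
  have fm: "finite_measure re_pos" "finite_measure re_neg" "finite_measure im_pos" "finite_measure im_neg"
    by unfold_locales
  note ** = *[OF fm(1) re.sets_jordan_pos] *[OF fm(2) nre.sets_jordan_pos]
    *[OF fm(3) im.sets_jordan_pos] *[OF fm(4) nim.sets_jordan_pos]
  show ?int unfolding complex_integral_def by (intro Bochner_Integration.integrable_add Bochner_Integration.integrable_diff integrable_mult_right **)
  show ?eq unfolding complex_integral_def by (simp add: **)
qed

lemma complex_integral_sum:
  fixes f :: "'i \<Rightarrow> 'a \<Rightarrow> complex"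
  assumes "\<And>i. i \<in> I \<Longrightarrow> f i \<in> borel_measurable M" "\<And>i x. i \<in> I \<Longrightarrow> norm (f i x) \<le> K"
  shows "complex_integral M \<mu> (\<lambda>x. \<Sum>i\<in>I. c i * f i x) = (\<Sum>i\<in>I. c i * complex_integral M \<mu> (f i))"
proof -
  have *: "(LINT x|m. (\<Sum>i\<in>I. c i * f i x)) = (\<Sum>i\<in>I. c i * (LINT x|m. f i x))"
    if "finite_measure m" "sets m = sets M" for m
  proof -
    interpret finite_measure m by fact
    have [measurable_cong]: "sets m = sets M" by fact
    have "integrable m (f i)" if "i \<in> I" for i
      using that assms by (intro integrable_const_bound[where B=K]) auto
    then show ?thesis
      by simp
  qed
  have fm: "finite_measure re_pos" "finite_measure re_neg" "finite_measure im_pos" "finite_measure im_neg"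
    by unfold_locales
  note ** = *[OF fm(1) re.sets_jordan_pos] *[OF fm(2) nre.sets_jordan_pos]
    *[OF fm(3) im.sets_jordan_pos] *[OF fm(4) nim.sets_jordan_pos]
  show ?thesis
    unfolding complex_integral_def **
    by (simp add: sum_subtractf sum.distrib sum_distrib_left algebra_simps)
qed

lemma complex_integral_cmult:
  assumes "f \<in> borel_measurable M" "\<And>x. norm (f x) \<le> K"
  shows "complex_integral M \<mu> (\<lambda>x. c * f x) = c * complex_integral M \<mu> f"
  using complex_integral_sum[of "{()}" "\<lambda>_. f" K "\<lambda>_. c"] assms by simp

end

lemma borel_measurable_cis [measurable]: "cis \<in> borel_measurable borel"
  by (intro borel_measurable_continuous_onI continuous_intros)

text \<open>Applied to t = x - y with x and y in [0,1): distinct representatives are distinct points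
  of the circle.\<close>

lemma cis_eq_1_imp_zero:
  assumes "cis (2 * pi * t) = 1" "\<bar>t\<bar> < 1"
  shows "t = 0"
proof -
  have "cos (2 * pi * t) = 1"
    using assms(1) by (metis cis.sel(1) one_complex.sel(1))
  then obtain n :: int where "2 * pi * t = of_int n * 2 * pi"
    unfolding cos_one_2pi_int by blast
  then have "t = of_int n" by simp
  with assms(2) show ?thesis by (simp flip: of_int_abs)
qed

section \<open>Averages of characters\<close>

text \<open>The Dirichlet kernel with its denominator multiplied out. The right-hand side has norm
  at most 2 for every N, which makes the means decay.\<close>

lemma sum_cis_mult:
  "(\<Sum>n\<in>{- int N..int N}. cis (of_int n * t)) * (cis t - 1) = cis (real (Suc N) * t) - cis (- (real N * t))"
proof (induction N)
  case 0
  show ?case by simp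
next
  case (Suc N)
  have "{- int (Suc N)..int (Suc N)} = insert (- int (Suc N)) (insert (int (Suc N)) {- int N..int N})"
    by auto
  then have "(\<Sum>n\<in>{- int (Suc N)..int (Suc N)}. cis (of_int n * t)) =
      cis (- (real (Suc N) * t)) + (cis (real (Suc N) * t) + (\<Sum>n\<in>{- int N..int N}. cis (of_int n * t)))"
    by (simp add: algebra_simps)
  then have "(\<Sum>n\<in>{- int (Suc N)..int (Suc N)}. cis (of_int n * t)) * (cis t - 1) =
      (cis (- (real (Suc N) * t)) + cis (real (Suc N) * t)) * (cis t - 1)
      + (cis (real (Suc N) * t) - cis (- (real N * t)))"
    by (simp only: Suc.IH[symmetric]) (simp add: algebra_simps)
  also have "\<dots> = cis (real (Suc (Suc N)) * t) - cis (- (real (Suc N) * t))"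
    by (simp add: algebra_simps cis_mult)
  finally show ?case .
qed

lemma norm_mean_cis_le:
  "norm (\<Sum>n\<in>{- int N..int N}. cis (u n) / of_nat (2 * N + 1)) \<le> 1"
proof -
  have "norm (\<Sum>n\<in>{- int N..int N}. cis (u n) / of_nat (2 * N + 1))
      \<le> (\<Sum>n\<in>{- int N..int N}. 1 / real (2 * N + 1))"
    by (rule sum_norm_le) (simp add: norm_divide del: of_nat_Suc of_nat_add of_nat_mult)
  also have "\<dots> = 1" by (simp add: field_simps)
  finally show ?thesis .
qed

lemma mean_cis_tendsto_0:
  assumes "cis t \<noteq> 1"
  shows "(\<lambda>N. \<Sum>n\<in>{- int N..int N}. cis (of_int n * t) / of_nat (2 * N + 1)) \<longlonglongrightarrow> 0"
proof (rule Lim_null_comparison)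
  show "\<forall>\<^sub>F N in sequentially. norm (\<Sum>n\<in>{- int N..int N}. cis (of_int n * t) / of_nat (2 * N + 1))
      \<le> (2 / norm (cis t - 1)) / real (2 * N + 1)"
  proof (intro always_eventually allI)
    fix N
    have "norm ((\<Sum>n\<in>{- int N..int N}. cis (of_int n * t)) * (cis t - 1)) \<le> 2"
      unfolding sum_cis_mult by (rule order_trans[OF norm_triangle_ineq4]) simp
    then have "norm (\<Sum>n\<in>{- int N..int N}. cis (of_int n * t)) \<le> 2 / norm (cis t - 1)"
      using assms unfolding norm_mult by (subst pos_le_divide_eq) auto
    then show "norm (\<Sum>n\<in>{- int N..int N}. cis (of_int n * t) / of_nat (2 * N + 1))
      \<le> (2 / norm (cis t - 1)) / real (2 * N + 1)"
      unfolding sum_divide_distrib[symmetric] norm_divide norm_of_nat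
      by (intro divide_right_mono) auto
  qed
  show "(\<lambda>N. (2 / norm (cis t - 1)) / real (2 * N + 1)) \<longlonglongrightarrow> 0"
    by real_asymp
qed

section \<open>Characters averaged over symmetric intervals\<close>

lemma has_bochner_integral_cis:
  assumes "a \<le> b" "t \<noteq> 0"
  shows "has_bochner_integral lborel (\<lambda>x. indicator {a..b} x *\<^sub>R cis (t * x))
    ((cis (t * b) - cis (t * a)) / (\<i> * of_real t))"
proof -
  have "has_bochner_integral lborel (\<lambda>x. indicator {a..b} x *\<^sub>R cis (t * x))
    (cis (t * b) / (\<i> * of_real t) - cis (t * a) / (\<i> * of_real t))"
  proof (rule has_bochner_integral_FTC_Icc[OF \<open>a \<le> b\<close>])
    fix x
    have "((\<lambda>x. cis (t * x) / (\<i> * of_real t)) has_vector_derivative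
        (t *\<^sub>R (\<i> * cis (t * x))) / (\<i> * of_real t)) (at x within {a..b})"
      unfolding has_vector_derivative_def
      by (auto intro!: derivative_eq_intros simp: fun_eq_iff scaleR_conv_of_real field_simps)
    then show "((\<lambda>x. cis (t * x) / (\<i> * of_real t)) has_vector_derivative cis (t * x)) (at x within {a..b})"
      using \<open>t \<noteq> 0\<close> by (simp add: scaleR_conv_of_real)
  qed (intro continuous_intros)
  then show ?thesis by (simp add: diff_divide_distrib)
qed

text \<open>The average over [-T, T] is written as an integral against a probability measure, so
  that the results for finite measures, in particular \<open>complex_integral_Fubini\<close>, apply
  to it.\<close>

definition unif :: "real \<Rightarrow> real measure" where
  "unif T = density lborel (\<lambda>x. ennreal (indicator {- T..T} x / (2 * T)))"

lemma sets_unif [simp, measurable_cong]: "sets (unif T) = sets borel"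
  and space_unif [simp]: "space (unif T) = UNIV"
  by (simp_all add: unif_def)

lemma integral_unif:
  fixes f :: "real \<Rightarrow> complex"
  assumes "T > 0" and [measurable]: "f \<in> borel_measurable borel"
  shows "(LINT x|unif T. f x) = (LINT x|lborel. indicator {- T..T} x *\<^sub>R f x) / of_real (2 * T)"
proof -
  have "(LINT x|unif T. f x) = (LINT x|lborel. (indicator {- T..T} x / (2 * T)) *\<^sub>R f x)"
    unfolding unif_def using assms(1) by (subst integral_density) auto
  also have "\<dots> = (LINT x|lborel. (1 / (2 * T)) *\<^sub>R (indicator {- T..T} x *\<^sub>R f x))"
    by simp
  also have "\<dots> = (LINT x|lborel. indicator {- T..T} x *\<^sub>R f x) / of_real (2 * T)"
    by (subst integral_scaleR_right) (simp add: scaleR_conv_of_real)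
  finally show ?thesis .
qed

lemma emeasure_unif_UNIV: "T > 0 \<Longrightarrow> emeasure (unif T) UNIV = 1"
proof -
  assume T: "T > 0"
  have "emeasure (unif T) UNIV = (\<integral>\<^sup>+x. ennreal (1 / (2 * T)) * indicator {- T..T} x \<partial>lborel)"
    unfolding unif_def using T
    by (subst emeasure_density) (auto intro!: nn_integral_cong simp: indicator_def)
  also have "\<dots> = 1"
    using T by (subst nn_integral_cmult_indicator) (auto simp flip: ennreal_mult)
  finally show ?thesis .
qed

lemma finite_measure_unif: "T > 0 \<Longrightarrow> finite_measure (unif T)"
  by standard (simp add: emeasure_unif_UNIV)

lemma norm_integral_unif_le:
  fixes f :: "real \<Rightarrow> complex"
  assumes "T > 0" "f \<in> borel_measurable borel" "\<And>x. norm (f x) \<le> 1"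
  shows "norm (LINT x|unif T. f x) \<le> 1"
  using norm_integral_le_measure[OF finite_measure_unif[OF assms(1)], of f] assms
  by (simp add: measure_def emeasure_unif_UNIV)

text \<open>The integral of a nonconstant character over any interval is at most 2 / |t|, while the
  length grows. \<open>Suc N\<close> avoids \<open>unif 0\<close>, which is the zero
  measure.\<close>

lemma mean_cis_unif_tendsto_0:
  assumes "t \<noteq> 0"
  shows "(\<lambda>N. LINT x|unif (real (Suc N)). cis (t * x)) \<longlonglongrightarrow> 0"
proof (rule Lim_null_comparison)
  show "\<forall>\<^sub>F N in sequentially. norm (LINT x|unif (real (Suc N)). cis (t * x))
      \<le> (2 / \<bar>t\<bar>) / (2 * real (Suc N))"
  proof (intro always_eventually allI)
    fix N
    have "norm (cis (t * real (Suc N)) - cis (t * - real (Suc N))) \<le> 2"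
      by (rule order_trans[OF norm_triangle_ineq4]) simp
    moreover have "(LINT x|lborel. indicator {- real (Suc N)..real (Suc N)} x *\<^sub>R cis (t * x)) =
        (cis (t * real (Suc N)) - cis (t * - real (Suc N))) / (\<i> * of_real t)"
      using assms by (intro has_bochner_integral_integral_eq has_bochner_integral_cis) auto
    ultimately have "norm (LINT x|lborel. indicator {- real (Suc N)..real (Suc N)} x *\<^sub>R cis (t * x)) \<le> 2 / \<bar>t\<bar>"
      by (simp add: norm_divide norm_mult divide_right_mono del: of_nat_Suc)
    then show "norm (LINT x|unif (real (Suc N)). cis (t * x)) \<le> (2 / \<bar>t\<bar>) / (2 * real (Suc N))"
      by (subst integral_unif) (auto simp: norm_divide norm_mult simp del: of_nat_Suc divide_divide_eq_left
          intro!: divide_right_mono)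
  qed
  show "(\<lambda>N. (2 / \<bar>t\<bar>) / (2 * real (Suc N))) \<longlonglongrightarrow> 0"
    by real_asymp
qed

section \<open>Wiener's formulas for point masses\<close>

text \<open>Moving the finite sum inside the integral turns the mean into the integral of the
  averaged characters at x - y. On [0,1) these converge boundedly to the indicator of {x}.\<close>

lemma mean_fourier_T_tendsto:
  assumes "complex_measure borel_T \<nu>" and x: "x \<in> {0..<1}"
  shows "(\<lambda>N. (\<Sum>n\<in>{- int N..int N}. cis (2 * pi * of_int n * x) * fourier_measure_T \<nu> n) / of_nat (2 * N + 1))
    \<longlonglongrightarrow> \<nu> {x}"
proof -
  interpret complex_measure_on borel_T \<nu> by standard fact
  define f where "f N y = (\<Sum>n\<in>{- int N..int N}.
    (cis (2 * pi * of_int n * x) / of_nat (2 * N + 1)) * cis (- 2 * pi * of_int n * y))" for N y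
  have f_eq: "f N y = (\<Sum>n\<in>{- int N..int N}. cis (of_int n * (2 * pi * (x - y))) / of_nat (2 * N + 1))" for N y
    unfolding f_def by (simp add: cis_mult algebra_simps)
  have "(\<lambda>N. complex_integral borel_T \<nu> (f N)) \<longlonglongrightarrow> complex_integral borel_T \<nu> (indicator {x})"
  proof (rule tendsto_complex_integral)
    show "f N \<in> borel_measurable borel_T" for N
      unfolding f_def by (intro measurable_restrict_space1) measurable
    show "indicator {x} \<in> borel_measurable borel_T"
      by (intro measurable_restrict_space1) measurable
    show "norm (f N y) \<le> 1" for N y
      unfolding f_eq by (rule norm_mean_cis_le)
    fix y assume "y \<in> space borel_T"
    then have y: "y \<in> {0..<1}" by (simp add: space_restrict_space)
    show "(\<lambda>N. f N y) \<longlonglongrightarrow> indicator {x} y"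
    proof (cases "y = x")
      case True
      have "f N y = (\<Sum>n\<in>{- int N..int N}. 1 / of_nat (2 * N + 1))" for N
        unfolding f_eq True by simp
      moreover have "card {- int N..int N} = 2 * N + 1" for N
        by simp
      moreover have "of_nat (2 * N + 1) \<noteq> (0 :: complex)" for N
        by (simp only: of_nat_eq_0_iff)
      ultimately have "f N y = 1" for N
        by (simp only: sum_constant) simp
      with True show ?thesis by simp
    next
      case False
      moreover have "\<bar>x - y\<bar> < 1"
        using x y by (simp add: abs_less_iff)
      ultimately have "cis (2 * pi * (x - y)) \<noteq> 1"
        using cis_eq_1_imp_zero[of "x - y"] by auto
      with False show ?thesis
        unfolding f_eq using mean_cis_tendsto_0[of "2 * pi * (x - y)"] by simp
    qed
  qed
  moreover have "complex_integral borel_T \<nu> (indicator {x}) = \<nu> {x}"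
    using x by (intro complex_integral_indicator) (auto simp: sets_restrict_space_iff)
  moreover have "complex_integral borel_T \<nu> (f N) =
    (\<Sum>n\<in>{- int N..int N}. cis (2 * pi * of_int n * x) * fourier_measure_T \<nu> n) / of_nat (2 * N + 1)" for N
    unfolding f_def sum_divide_distrib fourier_measure_T_def
    by (subst complex_integral_sum[where K=1]) (auto intro!: measurable_restrict_space1)
  ultimately show ?thesis by simp
qed

text \<open>The continuous analogue: Fubini moves the average over \<xi> inside the integral against
  \<mu>, where it equals 1 at y = x and tends to 0 elsewhere.\<close>

lemma mean_fourier_R_tendsto:
  assumes "complex_measure borel \<mu>"
  shows "(\<lambda>N. LINT \<xi>|unif (real (Suc N)). cis (2 * pi * \<xi> * x) * fourier_measure_R \<mu> \<xi>) \<longlonglongrightarrow> \<mu> {x}"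
    and "fourier_measure_R \<mu> \<in> borel_measurable borel"
proof -
  interpret complex_measure_on borel \<mu> by standard fact
  define g where "g \<xi> y = cis (2 * pi * \<xi> * x) * cis (- 2 * pi * \<xi> * y)" for \<xi> y :: real
  have g_eq: "g \<xi> y = cis (2 * pi * (x - y) * \<xi>)" for \<xi> y
    by (simp add: g_def cis_mult algebra_simps)
  have gF: "complex_integral borel \<mu> (g \<xi>) = cis (2 * pi * \<xi> * x) * fourier_measure_R \<mu> \<xi>" for \<xi>
    unfolding g_def fourier_measure_R_def by (rule complex_integral_cmult[where K=1]) auto
  have meas: "case_prod g \<in> borel_measurable (unif T \<Otimes>\<^sub>M borel)" for T
    unfolding g_eq[abs_def] by measurable
  note Fub = complex_integral_Fubini[OF finite_measure_unif meas, where K=1]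
  have "(\<lambda>N. complex_integral borel \<mu> (\<lambda>y. LINT \<xi>|unif (real (Suc N)). g \<xi> y))
    \<longlonglongrightarrow> complex_integral borel \<mu> (indicator {x})"
  proof (rule tendsto_complex_integral)
    show "(\<lambda>y. LINT \<xi>|unif (real (Suc N)). g \<xi> y) \<in> borel_measurable borel" for N
    proof -
      interpret finite_measure "unif (real (Suc N))" by (rule finite_measure_unif) simp
      show ?thesis unfolding g_eq by measurable
    qed
    show "norm (LINT \<xi>|unif (real (Suc N)). g \<xi> y) \<le> 1" for N y
      unfolding g_eq by (rule norm_integral_unif_le) auto
    fix y
    show "(\<lambda>N. LINT \<xi>|unif (real (Suc N)). g \<xi> y) \<longlonglongrightarrow> indicator {x} y"
    proof (cases "y = x")
      case True
      then have "(LINT \<xi>|unif (real (Suc N)). g \<xi> y) = 1" for N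
        unfolding g_eq by (simp add: measure_def emeasure_unif_UNIV del: of_nat_Suc)
      with True show ?thesis by simp
    next
      case False
      then show ?thesis
        unfolding g_eq using mean_cis_unif_tendsto_0[of "2 * pi * (x - y)"] by simp
    qed
  qed auto
  moreover have "complex_integral borel \<mu> (\<lambda>y. LINT \<xi>|unif (real (Suc N)). g \<xi> y) =
      (LINT \<xi>|unif (real (Suc N)). cis (2 * pi * \<xi> * x) * fourier_measure_R \<mu> \<xi>)" for N
    using Fub(2)[of "real (Suc N)"] by (simp add: g_eq flip: gF)
  ultimately show "(\<lambda>N. LINT \<xi>|unif (real (Suc N)). cis (2 * pi * \<xi> * x) * fourier_measure_R \<mu> \<xi>) \<longlonglongrightarrow> \<mu> {x}"
    by (simp add: complex_integral_indicator)
  \<comment> \<open>Measurability depends only on the Borel sets, so any positive T serves; T = 1 is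
    taken. The unimodular factor is then cancelled by its conjugate.\<close>
  have "(\<lambda>\<xi>. cis (2 * pi * \<xi> * x) * fourier_measure_R \<mu> \<xi>) \<in> borel_measurable borel"
    using Fub(1)[of 1, THEN borel_measurable_integrable]
    by (simp add: g_eq gF[symmetric] cong: measurable_cong_sets)
  then have "(\<lambda>\<xi>. cis (- 2 * pi * \<xi> * x) * (cis (2 * pi * \<xi> * x) * fourier_measure_R \<mu> \<xi>)) \<in> borel_measurable borel"
    by measurable
  then show "fourier_measure_R \<mu> \<in> borel_measurable borel"
    by (simp add: cis_mult flip: mult.assoc)
qed

section \<open>Kernels of compact support are integrable\<close>

text \<open>Brings the integral over [0,1) to the closed interval required by the fundamental
  theorem of calculus; the two differ by a null point.\<close>

lemma integral_lebesgue_T_cis: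
  "(LINT x|lebesgue_T. cis (t * x)) = (LINT x|lborel. indicator {0..1} x *\<^sub>R cis (t * x))"
proof -
  have "(LINT x|lebesgue_T. cis (t * x)) = (LINT x|lebesgue. indicator {0..<1} x *\<^sub>R cis (t * x))"
    by (subst integral_restrict_space) auto
  also have "\<dots> = (LINT x|lborel. indicator {0..<1} x *\<^sub>R cis (t * x))"
    by (rule integral_completion) simp
  also have "\<dots> = (LINT x|lborel. indicator {0..1} x *\<^sub>R cis (t * x))"
    using AE_lborel_singleton[of 1]
    by (intro integral_cong_AE) (auto simp: indicator_def elim!: eventually_mono)
  finally show ?thesis .
qed

lemma measure_lebesgue_T: "measure lebesgue_T {0..<1} = 1"
  by (subst measure_restrict_space) auto

lemma fourier_T_const: "fourier_T (\<lambda>_. c) n = (if n = 0 then c else 0)"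
proof (cases "n = 0")
  case True
  then show ?thesis
    by (simp add: fourier_T_def measure_lebesgue_T space_restrict_space)
next
  case False
  have "(LINT x|lborel. indicator {0..1} x *\<^sub>R cis ((- 2 * pi * of_int n) * x)) =
      (cis ((- 2 * pi * of_int n) * 1) - cis ((- 2 * pi * of_int n) * 0)) / (\<i> * of_real (- 2 * pi * of_int n))"
    using False by (intro has_bochner_integral_integral_eq has_bochner_integral_cis) auto
  also have "cis ((- 2 * pi * of_int n) * 1) = 1"
    using cis_multiple_2pi[of "of_int (- n)"] by simp
  finally have "(LINT x|lebesgue_T. cis ((- 2 * pi * of_int n) * x)) = 0"
    unfolding integral_lebesgue_T_cis by simp
  then show ?thesis
    using False unfolding fourier_T_def by (subst integral_mult_left_zero) simp
qed

text \<open>The operator replaces f by its mean, a constant whose modulus is at most the L1 norm of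
  f; hence the bound 1.\<close>

lemma delta_in_M1_Z: "(\<lambda>n. if n = 0 then 1 else 0) \<in> M1_Z"
proof -
  interpret finite_measure lebesgue_T
    by (rule finite_measure_lebesgue_on) (auto simp: fmeasurable_def)
  have "\<exists>g. integrable lebesgue_T g \<and> (\<forall>n. fourier_T g n = (if n = 0 then 1 else 0) * fourier_T f n) \<and>
      L1_norm lebesgue_T g \<le> 1 * L1_norm lebesgue_T f" if "integrable lebesgue_T f" for f
  proof (intro exI conjI allI)
    show "integrable lebesgue_T (\<lambda>_. fourier_T f 0)" by simp
    show "fourier_T (\<lambda>_. fourier_T f 0) n = (if n = 0 then 1 else 0) * fourier_T f n" for n
      by (simp add: fourier_T_const)
    have "norm (fourier_T f 0) \<le> L1_norm lebesgue_T f"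
      unfolding L1_norm_def fourier_T_def by simp
    then show "L1_norm lebesgue_T (\<lambda>_. fourier_T f 0) \<le> 1 * L1_norm lebesgue_T f"
      by (simp add: L1_norm_def measure_lebesgue_T space_restrict_space)
  qed
  then have "1 \<in> multiplier_bounds_Z (\<lambda>n. if n = 0 then 1 else 0)"
    unfolding multiplier_bounds_Z_def by auto
  then show ?thesis by (auto simp: M1_Z_def)
qed

text \<open>The kernel itself is W for the transform of Lebesgue measure on the circle.\<close>
lemma S1_R_subset_M1_R: "S1_R \<subseteq> M1_R"
proof
  fix \<Lambda> assume "\<Lambda> \<in> S1_R"
  then have "W (\<lambda>n. if n = 0 then 1 else 0) \<Lambda> \<in> M1_R"
    using delta_in_M1_Z by (auto simp: S1_R_def)
  moreover have "W_partial (\<lambda>n. if n = 0 then 1 else 0) \<Lambda> \<xi> N = \<Lambda> \<xi>" for \<xi> N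
  proof -
    have "W_partial (\<lambda>n. if n = 0 then 1 else 0) \<Lambda> \<xi> N
      = (\<Sum>n\<in>{- int N..int N}. if n = 0 then \<Lambda> \<xi> else 0)"
      unfolding W_partial_def by (intro sum.cong) auto
    then show ?thesis by simp
  qed
  then have "W_partial (\<lambda>n. if n = 0 then 1 else 0) \<Lambda> \<xi> = (\<lambda>_. \<Lambda> \<xi>)" for \<xi>
    by (intro ext)
  then have "W (\<lambda>n. if n = 0 then 1 else 0) \<Lambda> = \<Lambda>"
    unfolding W_def by (intro ext) (metis limI tendsto_const)
  ultimately show "\<Lambda> \<in> M1_R" by simp
qed

section \<open>Local boundedness of multipliers on the line\<close>

lemma integrable_mult_indicator_Icc:
  fixes f :: "real \<Rightarrow> complex"
  assumes "f \<in> borel_measurable borel" "\<And>x. norm (f x) \<le> B"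
  shows "integrable lborel (\<lambda>x. f x * indicator {a..b} x)"
proof -
  have "integrable lborel (\<lambda>x. indicator {a..b} x *\<^sub>R f x)"
    using assms by (intro integrableI_bounded_set_indicator[where B=B]) (auto simp: emeasure_lborel_Icc_eq)
  also have "(\<lambda>x. indicator {a..b} x *\<^sub>R f x) = (\<lambda>x. f x * indicator {a..b} x)"
    by (auto simp: indicator_def)
  finally show ?thesis .
qed

lemma norm_fourier_R_le: "norm (fourier_R g \<xi>) \<le> L1_norm lebesgue g"
  unfolding fourier_R_def L1_norm_def
  by (rule order_trans[OF integral_norm_bound]) (simp add: norm_mult)

text \<open>The constant 1/6 keeps the phase within pi/3, where the cosine is at least 1/2; the real
  part of the integrand then dominates half the indicator.\<close>

lemma norm_fourier_R_indicator_ge: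
  assumes "0 < d" "\<bar>\<xi>\<bar> * d \<le> 1 / 6"
  shows "d / 2 \<le> norm (fourier_R (indicator {0..d}) \<xi>)"
proof -
  let ?h = "\<lambda>x. cis (- 2 * pi * \<xi> * x) * indicator {0..d} x"
  have int: "integrable lborel (\<lambda>x. cis (- 2 * pi * \<xi> * x) * indicator {0..d} x)"
    by (rule integrable_mult_indicator_Icc[where B=1]) auto
  have "d / 2 = (LINT x|lborel. (1 / 2) * indicator {0..d} x)"
    using assms(1) by simp
  also have "\<dots> \<le> (LINT x|lborel. Re (?h x))"
  proof (rule integral_mono)
    show "integrable lborel (\<lambda>x. Re (?h x))"
      by (rule integrable_Re[OF int])
    show "integrable lborel (\<lambda>x. 1 / 2 * indicator {0..d} x :: real)"
      by (intro integrable_mult_right integrable_real_indicator) (auto simp: emeasure_lborel_Icc_eq)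
    fix x
    show "1 / 2 * indicator {0..d} x \<le> Re (?h x)"
    proof (cases "x \<in> {0..d}")
      case True
      then have "\<bar>\<xi>\<bar> * x \<le> 1 / 6"
        using mult_left_mono[of x d "\<bar>\<xi>\<bar>"] assms by auto
      then have "\<bar>2 * pi * \<xi> * x\<bar> \<le> pi / 3"
        using True mult_left_mono[of "\<bar>\<xi>\<bar> * x" "1/6" "2 * pi"] by (simp add: abs_mult mult.assoc)
      then have "cos (pi / 3) \<le> cos \<bar>2 * pi * \<xi> * x\<bar>"
        by (intro cos_monotone_0_pi_le) auto
      with True show ?thesis
        by (simp add: cos_60 abs_mult[symmetric])
    qed simp
  qed
  also have "\<dots> = Re (LINT x|lborel. ?h x)"
    using int by (rule integral_Re)
  also have "\<dots> \<le> norm (LINT x|lborel. ?h x)"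
    by (rule complex_Re_le_cmod)
  also have "(LINT x|lborel. ?h x) = fourier_R (indicator {0..d}) \<xi>"
    unfolding fourier_R_def by (rule integral_completion[symmetric]) measurable
  finally show ?thesis .
qed

text \<open>
  A multiplier is a quotient of two Fourier transforms of integrable functions, and the
  denominator can be bounded away from zero on any given bounded set.
\<close>
lemma M1_R_locally_bounded:
  assumes "m \<in> M1_R" "0 < R"
  shows "\<exists>B. AE \<xi> in lebesgue. \<bar>\<xi>\<bar> \<le> R \<longrightarrow> norm (m \<xi>) \<le> B"
proof -
  \<comment> \<open>The largest width to which \<open>norm_fourier_R_indicator_ge\<close> applies at
    every frequency with |\<xi>| <= R.\<close>
  define d where "d = 1 / (6 * R)"
  have d: "0 < d" "R * d = 1 / 6" using assms(2) by (auto simp: d_def)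
  let ?f = "indicator {0..d} :: real \<Rightarrow> complex"
  have "integrable lebesgue ?f"
    using integrable_mult_indicator_Icc[of "\<lambda>_. 1" 1 0 d] by (subst integrable_completion) auto
  then obtain g where g: "AE \<xi> in lebesgue. fourier_R g \<xi> = m \<xi> * fourier_R ?f \<xi>"
    using assms(1) unfolding M1_R_def multiplier_bounds_R_def by blast
  have "norm (m \<xi>) \<le> L1_norm lebesgue g / (d / 2)"
    if "\<bar>\<xi>\<bar> \<le> R" "fourier_R g \<xi> = m \<xi> * fourier_R ?f \<xi>" for \<xi>
  proof -
    have "d / 2 \<le> norm (fourier_R ?f \<xi>)"
      using d mult_right_mono[OF that(1), of d] by (intro norm_fourier_R_indicator_ge) linarith+
    then have "norm (m \<xi>) * (d / 2) \<le> norm (m \<xi> * fourier_R ?f \<xi>)"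
      unfolding norm_mult by (intro mult_left_mono) auto
    also have "\<dots> \<le> L1_norm lebesgue g"
      unfolding that(2)[symmetric] by (rule norm_fourier_R_le)
    finally show ?thesis
      using d by (subst pos_le_divide_eq) auto
  qed
  with g show ?thesis
    by (intro exI[of _ "L1_norm lebesgue g / (d / 2)"]) (auto elim!: eventually_mono)
qed

text \<open>The open sets in the definition may be uncountably many, and so may their exceptional
  null sets. Lindelof leaves a countable subfamily with the same union.\<close>

lemma AE_zero_outside_ess_support:
  "AE x in lebesgue. x \<notin> ess_support \<Lambda> \<longrightarrow> \<Lambda> x = 0"
proof -
  let ?F = "{U. open U \<and> (AE x in lebesgue. x \<in> U \<longrightarrow> \<Lambda> x = 0)}"
  obtain F' where F': "F' \<subseteq> ?F" "countable F'" "\<Union>F' = \<Union>?F"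
    by (rule Lindelof[of ?F]) auto
  have "AE x in lebesgue. \<forall>U\<in>F'. x \<in> U \<longrightarrow> \<Lambda> x = 0"
    using F'(1,2) by (subst AE_ball_countable) auto
  moreover have "- ess_support \<Lambda> = \<Union>F'"
    unfolding ess_support_def F'(3) by simp
  ultimately show ?thesis
    by (auto elim!: eventually_mono)
qed

text \<open>Replaces almost everywhere information by pointwise information: later the kernel is
  translated, integrated over \<open>lborel\<close> and evaluated at all \<xi> - n.\<close>

lemma kernel_borel_version:
  assumes "\<Lambda> \<in> S1_R" "compact (ess_support \<Lambda>)"
  obtains \<Lambda>' and R :: nat where "integrable lborel \<Lambda>'"
    "\<And>u. real R \<le> \<bar>u\<bar> \<Longrightarrow> \<Lambda>' u = 0" "AE u in lborel. \<Lambda> u = \<Lambda>' u"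
proof -
  obtain r where r: "\<And>x. x \<in> ess_support \<Lambda> \<Longrightarrow> \<bar>x\<bar> \<le> r"
    using compact_imp_bounded[OF assms(2)] by (auto simp: bounded_iff)
  \<comment> \<open>Strictly above r, so that every u with |u| >= R is outside the essential
    support; positive, as the local bound requires.\<close>
  obtain R :: nat where R: "max r 0 < real R" using reals_Archimedean2 by blast
  obtain B where B: "AE \<xi> in lborel. \<bar>\<xi>\<bar> \<le> R \<longrightarrow> norm (\<Lambda> \<xi>) \<le> B"
    using M1_R_locally_bounded[of \<Lambda> R] assms(1) S1_R_subset_M1_R R by (auto simp: AE_completion_iff)
  have "\<Lambda> \<in> borel_measurable lebesgue"
    using assms(1) by (simp add: S1_R_def)
  then have "(\<lambda>u. Re (\<Lambda> u)) \<in> borel_measurable lebesgue" "(\<lambda>u. Im (\<Lambda> u)) \<in> borel_measurable lebesgue"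
    by simp_all
  then obtain p q where [measurable]: "p \<in> borel_measurable borel" "q \<in> borel_measurable borel"
    and pq: "AE u in lborel. Re (\<Lambda> u) = p u" "AE u in lborel. Im (\<Lambda> u) = q u"
    by (auto dest!: completion_ex_borel_measurable_real)
  define \<Lambda>\<^sub>0 where "\<Lambda>\<^sub>0 u = of_real (p u) + \<i> * of_real (q u)" for u
  have [measurable]: "\<Lambda>\<^sub>0 \<in> borel_measurable borel" unfolding \<Lambda>\<^sub>0_def by measurable
  \<comment> \<open>Both tests alter the Borel version on a null set only, and they make the
    function bounded with compact support everywhere.\<close>
  define \<Lambda>' where "\<Lambda>' u = (if \<bar>u\<bar> < real R \<and> norm (\<Lambda>\<^sub>0 u) \<le> B then \<Lambda>\<^sub>0 u else 0)" for u
  have [measurable]: "\<Lambda>' \<in> borel_measurable borel" unfolding \<Lambda>'_def by measurable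
  show thesis
  proof
    have "integrable lborel (\<lambda>u. indicator {- real R..real R} u *\<^sub>R \<Lambda>' u)"
    proof (rule integrableI_bounded_set_indicator[where B="\<bar>B\<bar>"])
      show "AE u in lborel. u \<in> {- real R..real R} \<longrightarrow> norm (\<Lambda>' u) \<le> \<bar>B\<bar>"
        by (auto simp: \<Lambda>'_def)
    qed (auto simp: emeasure_lborel_Icc_eq)
    also have "(\<lambda>u. indicator {- real R..real R} u *\<^sub>R \<Lambda>' u) = \<Lambda>'"
      by (auto simp: \<Lambda>'_def indicator_def fun_eq_iff)
    finally show "integrable lborel \<Lambda>'" .
    show "\<Lambda>' u = 0" if "real R \<le> \<bar>u\<bar>" for u
      using that by (simp add: \<Lambda>'_def)
    have "AE u in lborel. u \<notin> ess_support \<Lambda> \<longrightarrow> \<Lambda> u = 0"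
      using AE_zero_outside_ess_support by (simp add: AE_completion_iff)
    then show "AE u in lborel. \<Lambda> u = \<Lambda>' u"
      using B pq
    proof eventually_elim
      case (elim u)
      then have "\<Lambda> u = \<Lambda>\<^sub>0 u" by (simp add: \<Lambda>\<^sub>0_def complex_eq_iff)
      then show ?case
        using elim(1,2) r[of u] R by (cases "\<bar>u\<bar> < real R") (auto simp: \<Lambda>'_def)
    qed
  qed
qed

text \<open>Countably many translates of a null set are still null. This lets \<Lambda> be replaced
  in all terms of the series simultaneously.\<close>

lemma AE_lborel_integer_translates:
  assumes "AE u in lborel. P (u :: real)"
  shows "AE \<xi> in lborel. \<forall>n::int. P (\<xi> - of_int n)"
proof -
  obtain N where N: "{u. \<not> P u} \<subseteq> N" "N \<in> null_sets lborel"
    using AE_E[OF assms] by (auto simp: null_sets_def)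
  then have [measurable]: "N \<in> sets borel" by auto
  have "AE u in lborel. u \<notin> N" by (rule AE_not_in[OF N(2)])
  then have "AE \<xi> in lborel. - of_int n + 1 * \<xi> \<notin> N" for n :: int
    by (intro AE_borel_affine) auto
  then have "AE \<xi> in lborel. \<forall>n::int. - of_int n + 1 * \<xi> \<notin> N"
    by (subst AE_all_countable) auto
  then show ?thesis
    using N(1) by (auto elim!: eventually_mono)
qed

text \<open>A nonzero term needs |\<xi> - n| < R, hence |n| < N + R, and the partial sums are
  constant from N + R on. The range depends on N but not on \<xi>, which allows termwise integration
  over [-N, N].\<close>

lemma W_eq_finite_sum:
  assumes "\<And>n. \<Lambda> (\<xi> - of_int n) = \<Lambda>' (\<xi> - of_int n)" "\<And>u. real R \<le> \<bar>u\<bar> \<Longrightarrow> \<Lambda>' u = 0"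
    and "\<bar>\<xi>\<bar> \<le> real N"
  shows "W a \<Lambda> \<xi> = (\<Sum>n\<in>{- int (N + R)..int (N + R)}. a n * \<Lambda>' (\<xi> - of_int n))"
proof -
  have "W_partial a \<Lambda> \<xi> M = (\<Sum>n\<in>{- int (N + R)..int (N + R)}. a n * \<Lambda>' (\<xi> - of_int n))"
    if "M \<ge> N + R" for M
    unfolding W_partial_def assms(1)
  proof (rule sum.mono_neutral_right)
    have "\<Lambda>' (\<xi> - of_int n) = 0" if "int (N + R) < \<bar>n\<bar>" for n
    proof (rule assms(2))
      have "real (N + R) < \<bar>real_of_int n\<bar>"
        using that by (metis of_int_abs of_int_less_iff of_int_of_nat_eq)
      then show "real R \<le> \<bar>\<xi> - of_int n\<bar>" using assms(3) by simp
    qed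
    then show "\<forall>n\<in>{- int M..int M} - {- int (N + R)..int (N + R)}. a n * \<Lambda>' (\<xi> - of_int n) = 0"
      by auto
  qed (use that in auto)
  then have "W_partial a \<Lambda> \<xi> \<longlonglongrightarrow> (\<Sum>n\<in>{- int (N + R)..int (N + R)}. a n * \<Lambda>' (\<xi> - of_int n))"
    by (intro tendsto_eventually) (auto simp: eventually_sequentially)
  then show ?thesis
    unfolding W_def by (rule limI)
qed

section \<open>Point masses of the transferred measure\<close>

lemma fourier_measure_T_bounded:
  assumes "complex_measure borel_T \<nu>"
  shows "\<exists>K. \<forall>n. norm (fourier_measure_T \<nu> n) \<le> K"
proof -
  interpret complex_measure_on borel_T \<nu> by standard fact
  show ?thesis
    unfolding fourier_measure_T_def
    by (intro exI[of _ variation_bound] allI norm_complex_integral_le) (auto intro!: measurable_restrict_space1)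
qed

text \<open>Integer frequencies see x only modulo 1, so a point of the line can be moved to its
  representative in [0,1).\<close>

lemma cis_integer_frac: "cis (2 * pi * of_int n * frac x) = cis (2 * pi * of_int n * x)"
proof -
  have "cis (2 * pi * of_int n * x) = cis (2 * pi * of_int n * frac x + 2 * pi * of_int (n * \<lfloor>x\<rfloor>))"
    by (simp add: frac_def algebra_simps)
  also have "\<dots> = cis (2 * pi * of_int n * frac x)"
    by (subst cis_mult[symmetric]) simp
  finally show ?thesis by simp
qed

text \<open>These are the n for which the translated support may reach an end of [-N, N]: two blocks
  of 2R consecutive integers, which overlap when R > N.\<close>

lemma card_boundary_le:
  "card {n \<in> {- int (N + R)..int (N + R)}. real N - real R < \<bar>of_int n\<bar>} \<le> 4 * R"
proof -
  have "{n \<in> {- int (N + R)..int (N + R)}. real N - real R < \<bar>of_int n\<bar>} \<subseteq>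
      {- int (N + R)..int R - int N - 1} \<union> {int N - int R + 1..int (N + R)}" (is "?A \<subseteq> ?B \<union> ?C")
  proof
    fix n assume n: "n \<in> ?A"
    then have "real_of_int (int N - int R) < real_of_int \<bar>n\<bar>" by simp
    then have "int N - int R < \<bar>n\<bar>" by (simp only: of_int_less_iff)
    with n show "n \<in> ?B \<union> ?C" by auto
  qed
  then have "card ?A \<le> card (?B \<union> ?C)" by (intro card_mono) auto
  also have "\<dots> \<le> card ?B + card ?C" by (rule card_Un_le)
  also have "\<dots> \<le> 4 * R" by simp
  finally show ?thesis .
qed

lemma weighted_sum_diff:
  fixes c :: "'a :: comm_ring"
  shows "(\<Sum>n\<in>I. a n * b n) - c * (\<Sum>n\<in>I. e n * a n) = (\<Sum>n\<in>I. a n * (b n - e n * c))"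
  by (simp add: sum_distrib_left sum_subtractf algebra_simps)

lemma norm_weighted_sum_le:
  fixes a b :: "'i \<Rightarrow> complex"
  assumes "finite I" "0 \<le> D" and a: "\<And>n. n \<in> I \<Longrightarrow> norm (a n) \<le> K"
    and b: "\<And>n. n \<in> I \<Longrightarrow> norm (b n) \<le> (if n \<in> E then D else 0)"
  shows "norm (\<Sum>n\<in>I. a n * b n) \<le> real (card (I \<inter> E)) * (K * D)"
proof -
  have "norm (\<Sum>n\<in>I. a n * b n) \<le> (\<Sum>n\<in>I. if n \<in> E then K * D else 0)"
  proof (rule sum_norm_le)
    fix n assume n: "n \<in> I"
    have "norm (a n * b n) \<le> K * (if n \<in> E then D else 0)"
      unfolding norm_mult using a[OF n] by (intro mult_mono b n) (auto intro: order_trans[OF norm_ge_zero])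
    then show "norm (a n * b n) \<le> (if n \<in> E then K * D else 0)" by auto
  qed
  also have "\<dots> = (\<Sum>n\<in>I \<inter> E. K * D)"
    using \<open>finite I\<close> by (rule sum.inter_restrict[symmetric])
  finally show ?thesis by simp
qed

text \<open>
  For most n the interval of integration contains the support of the translated kernel, so that
  the truncated integral is the full one; each of the remaining n contributes a bounded error.
\<close>
lemma truncated_sum_error:
  fixes \<Lambda> :: "real \<Rightarrow> complex"
  assumes int: "integrable lborel \<Lambda>" and supp: "\<And>u. real R \<le> \<bar>u\<bar> \<Longrightarrow> \<Lambda> u = 0"
    and K: "\<And>n. norm (a n) \<le> K"
  shows "norm ((\<Sum>n\<in>{- int (N + R)..int (N + R)}. a n *
        (LINT \<xi>|lborel. indicator {- real N..real N} \<xi> *\<^sub>R (cis (2 * pi * \<xi> * x) * \<Lambda> (\<xi> - of_int n))))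
      - (LINT u|lborel. cis (2 * pi * u * x) * \<Lambda> u) *
        (\<Sum>n\<in>{- int (N + R)..int (N + R)}. cis (2 * pi * of_int n * x) * a n))
    \<le> real (4 * R) * (K * (LINT u|lborel. norm (\<Lambda> u)))"
    (is "norm ((\<Sum>n\<in>?I. a n * ?J n) - ?c * _) \<le> _")
proof -
  have [measurable]: "\<Lambda> \<in> borel_measurable borel"
    using borel_measurable_integrable[OF int] by simp
  let ?D = "LINT u|lborel. norm (\<Lambda> u)"
  have D: "0 \<le> ?D" by simp
  let ?E = "{n::int. real N - real R < \<bar>of_int n\<bar>}"
  let ?f = "\<lambda>n \<xi>. cis (2 * pi * \<xi> * x) * \<Lambda> (\<xi> - of_int n)"
  have "0 \<le> K" using norm_ge_zero K by (rule order_trans)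
  have int_tr: "integrable lborel (\<lambda>\<xi>. \<Lambda> (\<xi> - of_int n))"
    and norm_tr: "(LINT \<xi>|lborel. norm (\<Lambda> (\<xi> - of_int n))) = ?D" for n
    using lborel_integrable_real_affine[OF int, of 1 "- of_int n"]
      lborel_integral_real_affine[of 1 "\<lambda>u. norm (\<Lambda> u)" "- of_int n"] by simp_all
  have int_f: "integrable lborel (?f n)" for n
    by (rule Bochner_Integration.integrable_bound[OF int_tr[of n]]) (auto simp: norm_mult)
  have int_J: "integrable lborel (\<lambda>\<xi>. indicator {- real N..real N} \<xi> *\<^sub>R ?f n \<xi>)" for n
    by (rule integrable_mult_indicator[OF _ int_f]) simp
  \<comment> \<open>The substitution \<xi> = n + u splits the character into a factor depending on n
    and the integral that is common to all n.\<close>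
  have full: "(LINT \<xi>|lborel. ?f n \<xi>) = cis (2 * pi * of_int n * x) * ?c" for n
  proof -
    have "cis (2 * pi * (of_int n + 1 * u) * x) = cis (2 * pi * of_int n * x) * cis (2 * pi * u * x)" for u
      by (simp add: cis_mult algebra_simps)
    then have "(LINT u|lborel. ?f n (of_int n + 1 * u)) = cis (2 * pi * of_int n * x) * ?c"
      by (simp add: mult.assoc)
    then show ?thesis
      by (subst lborel_integral_real_affine[of 1 "?f n" "of_int n"]) simp_all
  qed
  have err: "norm (?J n - cis (2 * pi * of_int n * x) * ?c) \<le> (if n \<in> ?E then ?D else 0)" if "n \<in> ?I" for n
  proof -
    have diff: "?J n - cis (2 * pi * of_int n * x) * ?c
        = (LINT \<xi>|lborel. indicator {- real N..real N} \<xi> *\<^sub>R ?f n \<xi> - ?f n \<xi>)"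
      unfolding full[of n, symmetric] by (rule Bochner_Integration.integral_diff[symmetric, OF int_J int_f])
    have "norm (LINT \<xi>|lborel. indicator {- real N..real N} \<xi> *\<^sub>R ?f n \<xi> - ?f n \<xi>)
        \<le> (if n \<in> ?E then ?D else 0)"
    proof (cases "n \<in> ?E")
      case True
      have "norm (LINT \<xi>|lborel. indicator {- real N..real N} \<xi> *\<^sub>R ?f n \<xi> - ?f n \<xi>)
          \<le> (LINT \<xi>|lborel. norm (indicator {- real N..real N} \<xi> *\<^sub>R ?f n \<xi> - ?f n \<xi>))"
        by (rule integral_norm_bound)
      \<comment> \<open>Truncation keeps or deletes the integrand at each point, so the difference
        is bounded by the translated kernel, whose integral is \<open>?D\<close> by translation
        invariance.\<close>
      also have "\<dots> \<le> (LINT \<xi>|lborel. norm (\<Lambda> (\<xi> - of_int n)))"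
        by (intro integral_mono integrable_norm Bochner_Integration.integrable_diff int_J int_f int_tr)
           (auto simp: indicator_def norm_mult)
      finally show ?thesis using True norm_tr by simp
    next
      case False
      with that have n: "\<bar>real_of_int n\<bar> \<le> real N - real R" by auto
      have "indicator {- real N..real N} \<xi> *\<^sub>R ?f n \<xi> - ?f n \<xi> = 0" for \<xi>
      proof (cases "\<xi> \<in> {- real N..real N}")
        case False
        then have "real R \<le> \<bar>\<xi> - of_int n\<bar>" using n by auto
        then show ?thesis by (simp add: supp)
      qed simp
      then have "(\<lambda>\<xi>. indicator {- real N..real N} \<xi> *\<^sub>R ?f n \<xi> - ?f n \<xi>) = (\<lambda>_. 0)"
        by (intro ext)
      then show ?thesis using False by simp
    qed
    then show ?thesis unfolding diff .
  qed
  define J where "J n = ?J n" for n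
  define e where "e n = cis (2 * pi * of_int n * x)" for n :: int
  define c where "c = ?c"
  define D' where "D' = ?D"
  define E where "E = ?E"
  have "norm (\<Sum>n\<in>?I. a n * (J n - e n * c)) \<le> real (card (?I \<inter> E)) * (K * D')"
  proof (rule norm_weighted_sum_le[OF finite_atLeastAtMost_int])
    show "norm (J n - e n * c) \<le> (if n \<in> E then D' else 0)" if "n \<in> ?I" for n
      using err[OF that] unfolding J_def e_def c_def D'_def E_def .
  qed (use D in \<open>simp_all add: D'_def K\<close>)
  also have "\<dots> \<le> real (4 * R) * (K * D')"
  proof (intro mult_right_mono)
    have "?I \<inter> E = {n \<in> ?I. real N - real R < \<bar>of_int n\<bar>}" by (auto simp: E_def)
    then show "real (card (?I \<inter> E)) \<le> real (4 * R)"
      using card_boundary_le[of N R] by (simp only: of_nat_le_iff)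
    show "0 \<le> K * D'" using \<open>0 \<le> K\<close> D by (simp add: D'_def)
  qed
  finally have "norm ((\<Sum>n\<in>?I. a n * J n) - c * (\<Sum>n\<in>?I. e n * a n)) \<le> real (4 * R) * (K * D')"
    by (simp only: weighted_sum_diff)
  then show ?thesis
    unfolding J_def e_def c_def D'_def .
qed

theorem theorem3p2:
  fixes \<Lambda> :: "real \<Rightarrow> complex" and \<nu> \<mu> :: "real set \<Rightarrow> complex"
  assumes "\<Lambda> \<in> S1_R"
    and "compact (ess_support \<Lambda>)"
    and "complex_measure borel_T \<nu>"
    and "complex_measure borel \<mu>"
    and "AE \<xi> in lebesgue. fourier_measure_R \<mu> \<xi> = W (fourier_measure_T \<nu>) \<Lambda> \<xi>"
    and "continuous_measure borel_T \<nu>"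
  shows "continuous_measure borel \<mu>"
proof -
  obtain \<Lambda>' and R :: nat where int: "integrable lborel \<Lambda>'"
    and supp: "\<And>u. real R \<le> \<bar>u\<bar> \<Longrightarrow> \<Lambda>' u = 0" and eq: "AE u in lborel. \<Lambda> u = \<Lambda>' u"
    by (rule kernel_borel_version[OF assms(1,2)]) blast
  have [measurable]: "\<Lambda>' \<in> borel_measurable borel"
    using borel_measurable_integrable[OF int] by simp
  have [measurable]: "fourier_measure_R \<mu> \<in> borel_measurable borel"
    by (rule mean_fourier_R_tendsto(2)[OF assms(4)])
  let ?a = "fourier_measure_T \<nu>"
  obtain K where K: "\<And>n. norm (?a n) \<le> K"
    using fourier_measure_T_bounded[OF assms(3)] by blast
  have "AE \<xi> in lborel. fourier_measure_R \<mu> \<xi> = W ?a \<Lambda> \<xi>"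
    using assms(5) by (simp add: AE_completion_iff)
  \<comment> \<open>The quantifier over N stands inside: one null set serves all N.\<close>
  then have F_eq: "AE \<xi> in lborel. \<forall>N. \<bar>\<xi>\<bar> \<le> real N \<longrightarrow>
      fourier_measure_R \<mu> \<xi> = (\<Sum>n\<in>{- int (N + R)..int (N + R)}. ?a n * \<Lambda>' (\<xi> - of_int n))"
    using AE_lborel_integer_translates[OF eq]
  proof eventually_elim
    case (elim \<xi>)
    show ?case
      using W_eq_finite_sum[of \<Lambda> \<xi> \<Lambda>' R _ ?a] elim supp by auto
  qed
  have "\<mu> {x} = 0" for x
  proof -
    define c where "c = (LINT u|lborel. cis (2 * pi * u * x) * \<Lambda>' u)"
    define D where "D = real (4 * R) * (K * (LINT u|lborel. norm (\<Lambda>' u)))"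
    define S where "S M = (\<Sum>n\<in>{- int M..int M}. cis (2 * pi * of_int n * x) * ?a n)" for M
    define A where "A N = (LINT \<xi>|unif (real N). cis (2 * pi * \<xi> * x) * fourier_measure_R \<mu> \<xi>)" for N
    let ?f = "\<lambda>n \<xi>. cis (2 * pi * \<xi> * x) * \<Lambda>' (\<xi> - of_int n)"
    \<comment> \<open>The average is multiplied by the length 2N. The sum runs to N + R because
      translates up to there can meet [-N, N], and D does not depend on N.\<close>
    have A: "norm (A N * of_nat (2 * N) - c * S (N + R)) \<le> D" if "N > 0" for N
    proof -
      let ?ind = "indicator {- real N..real N} :: real \<Rightarrow> real"
      have int_f: "integrable lborel (\<lambda>\<xi>. ?ind \<xi> *\<^sub>R ?f n \<xi>)" for n
      proof (rule integrable_mult_indicator)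
        have "integrable lborel (\<lambda>\<xi>. \<Lambda>' (\<xi> - of_int n))"
          using lborel_integrable_real_affine[OF int, of 1 "- of_int n"] by simp
        then show "integrable lborel (?f n)"
          by (rule Bochner_Integration.integrable_bound) (auto simp: norm_mult)
      qed simp
      have "A N * of_nat (2 * N) = (LINT \<xi>|lborel. ?ind \<xi> *\<^sub>R (cis (2 * pi * \<xi> * x) * fourier_measure_R \<mu> \<xi>))"
        unfolding A_def using that by (subst integral_unif) auto
      also have "\<dots> = (LINT \<xi>|lborel. (\<Sum>n\<in>{- int (N + R)..int (N + R)}. ?a n * (?ind \<xi> *\<^sub>R ?f n \<xi>)))"
      proof (rule integral_cong_AE)
        show "AE \<xi> in lborel. ?ind \<xi> *\<^sub>R (cis (2 * pi * \<xi> * x) * fourier_measure_R \<mu> \<xi>) =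
            (\<Sum>n\<in>{- int (N + R)..int (N + R)}. ?a n * (?ind \<xi> *\<^sub>R ?f n \<xi>))"
          using F_eq
        proof eventually_elim
          case (elim \<xi>)
          show ?case
          proof (cases "\<xi> \<in> {- real N..real N}")
            case True
            then have "fourier_measure_R \<mu> \<xi> = (\<Sum>n\<in>{- int (N + R)..int (N + R)}. ?a n * \<Lambda>' (\<xi> - of_int n))"
              using elim by (auto simp: abs_le_iff)
            with True show ?thesis
              by (simp add: sum_distrib_left mult_ac)
          qed simp
        qed
      qed measurable
      also have "\<dots> = (\<Sum>n\<in>{- int (N + R)..int (N + R)}. ?a n * (LINT \<xi>|lborel. ?ind \<xi> *\<^sub>R ?f n \<xi>))"
        by (subst Bochner_Integration.integral_sum)
           (rule integrable_mult_right[OF int_f], simp only: integral_mult_right_zero)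
      finally show ?thesis
        unfolding c_def D_def S_def using truncated_sum_error[OF int supp K, where N = N and x = x] by simp
    qed
    \<comment> \<open>The mass of \<mu> at x is governed by the mass of \<nu> at x modulo 1.\<close>
    have "(\<lambda>M. S M / of_nat (2 * M + 1)) \<longlonglongrightarrow> \<nu> {frac x}"
      using mean_fourier_T_tendsto[OF assms(3), of "frac x"]
      unfolding S_def cis_integer_frac by (simp add: frac_lt_1)
    moreover have "\<nu> {frac x} = 0"
      using assms(6) by (simp add: continuous_measure_def space_restrict_space frac_lt_1)
    ultimately have "(\<lambda>M. S M / of_nat (2 * M + 1)) \<longlonglongrightarrow> 0" by simp
    then have "(\<lambda>N. S (Suc N + R) / of_nat (2 * (Suc N + R) + 1)) \<longlonglongrightarrow> 0"
      using LIMSEQ_ignore_initial_segment[of "\<lambda>M. S M / of_nat (2 * M + 1)" 0 "Suc R"]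
      by (simp only: add_Suc add_Suc_right)
    then have S0: "(\<lambda>N. norm (S (Suc N + R) / of_nat (2 * (Suc N + R) + 1))) \<longlonglongrightarrow> 0"
      by (rule tendsto_norm_zero)
    have "(\<lambda>N. A (Suc N)) \<longlonglongrightarrow> 0"
    proof (rule Lim_null_comparison)
      \<comment> \<open>The circle mean divides by its 2 (N + R) + 1 terms (with
        \<open>Suc N\<close> for N), the line average by the length 2N. The ratio is split off as a
        factor tending to 1.\<close>
      show "\<forall>\<^sub>F N in sequentially. norm (A (Suc N)) \<le> D / real (2 * Suc N) + norm c *
         (norm (S (Suc N + R) / of_nat (2 * (Suc N + R) + 1)) * (real (2 * (Suc N + R) + 1) / real (2 * Suc N)))"
      proof (intro always_eventually allI)
        fix N
        let ?m = "real (2 * Suc N)" and ?k = "real (2 * (Suc N + R) + 1)"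
        have "norm (A (Suc N)) * ?m = norm (A (Suc N) * of_nat (2 * Suc N))"
          by (simp only: norm_mult norm_of_nat)
        also have "\<dots> \<le> D + norm (c * S (Suc N + R))"
          using A[of "Suc N"] norm_triangle_sub[of "A (Suc N) * of_nat (2 * Suc N)" "c * S (Suc N + R)"]
          by (auto simp del: of_nat_Suc of_nat_mult)
        finally have "norm (A (Suc N)) \<le> (D + norm (c * S (Suc N + R))) / ?m"
          by (subst pos_le_divide_eq) auto
        also have "\<dots> = D / ?m + norm c * (norm (S (Suc N + R)) / ?k * (?k / ?m))"
          by (simp add: norm_mult add_divide_distrib del: of_nat_Suc of_nat_add of_nat_mult)
        finally show "norm (A (Suc N)) \<le> D / ?m + norm c *
           (norm (S (Suc N + R) / of_nat (2 * (Suc N + R) + 1)) * (?k / ?m))"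
          by (simp only: norm_divide norm_of_nat)
      qed
      have "(\<lambda>N. real (2 * (Suc N + R) + 1) / real (2 * Suc N)) \<longlonglongrightarrow> 1"
        by real_asymp
      moreover have "(\<lambda>N. D / real (2 * Suc N)) \<longlonglongrightarrow> 0"
        by real_asymp
      ultimately have "(\<lambda>N. D / real (2 * Suc N) + norm c *
         (norm (S (Suc N + R) / of_nat (2 * (Suc N + R) + 1)) * (real (2 * (Suc N + R) + 1) / real (2 * Suc N))))
         \<longlonglongrightarrow> 0 + norm c * (0 * 1)"
        using S0 by (intro tendsto_intros)
      then show "(\<lambda>N. D / real (2 * Suc N) + norm c *
         (norm (S (Suc N + R) / of_nat (2 * (Suc N + R) + 1)) * (real (2 * (Suc N + R) + 1) / real (2 * Suc N))))
         \<longlonglongrightarrow> 0" by simp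
    qed
    moreover have "(\<lambda>N. A (Suc N)) \<longlonglongrightarrow> \<mu> {x}"
      unfolding A_def by (rule mean_fourier_R_tendsto(1)[OF assms(4)])
    ultimately show "\<mu> {x} = 0"
      by (rule LIMSEQ_unique[symmetric])
  qed
  then show ?thesis by (simp add: continuous_measure_def)
qed

end
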